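(* Let $q\in(\frac{1+\sqrt5}{2},q_{\aleph_0})$. Then there exists $x\in(0,\frac1{q-1})$ such that $\Sigma_q(x)$ is uncountable, and there exists $x\in(0,\frac1{q-1})$ with a unique $q$-expansion. Moreover, for every $x\in(0,\frac1{q-1})$ the set $\Sigma_q(x)$ is either uncountable or a singleton set.
   Context: For $q\in(1,2)$ and $x\in[0,\frac1{q-1}]$, a $q$-expansion of $x$ is a sequence $(\epsilon_i)_{i=1}^\infty\in\{0,1\}^{\mathbb N}$ with $x=\sum_{i=1}^\infty \epsilon_i q^{-i}$; $\Sigma_q(x)$ denotes the set of all $q$-expansions of $x$. The number $q_{\aleph_0}\approx1.64541$ is the root in $(1,2)$ of $x^6=x^4+x^3+2x^2+x+1$. *)

theory Defs
  imports Complex_Main "HOL-Library.Countable_Set"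
begin

text \<open>The digit written \<open>\<epsilon>\<^sub>i\<close> (with \<open>i \<ge> 1\<close>) in the literature is \<open>\<epsilon> (i - 1)\<close> here,
  so that digit sequences are total functions on \<^typ>\<open>nat\<close>; hence the exponent \<open>Suc i\<close>.\<close>

definition q_expansion :: "real \<Rightarrow> real \<Rightarrow> (nat \<Rightarrow> nat) \<Rightarrow> bool" where
  "q_expansion q x \<epsilon> \<longleftrightarrow> range \<epsilon> \<subseteq> {0, 1} \<and> (\<lambda>i. real (\<epsilon> i) / q ^ Suc i) sums x"

definition q_expansions :: "real \<Rightarrow> real \<Rightarrow> (nat \<Rightarrow> nat) set" where
  "q_expansions q x = {\<epsilon>. q_expansion q x \<epsilon>}"

definition q_aleph0 :: real where
  "q_aleph0 = (THE x. 1 < x \<and> x < 2 \<and> x ^ 6 = x ^ 4 + x ^ 3 + 2 * x ^ 2 + x + 1)"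

text \<open>The description defining \<^const>\<open>q_aleph0\<close> is proper.\<close>

lemma q_aleph0_ex1:
  "\<exists>!x::real. 1 < x \<and> x < 2 \<and> x ^ 6 = x ^ 4 + x ^ 3 + 2 * x ^ 2 + x + 1"
proof -
  let ?f = "\<lambda>x::real. x ^ 6 - (x ^ 4 + x ^ 3 + 2 * x ^ 2 + x + 1)"
  have "\<exists>x\<ge>1. x \<le> 2 \<and> ?f x = 0"
    by (rule IVT') (auto intro!: continuous_intros)
  then obtain x where x: "1 \<le> x" "x \<le> 2" "?f x = 0" by blast
  have "x \<noteq> 1" "x \<noteq> 2" using x(3) by auto
  then have ex: "1 < x \<and> x < 2 \<and> x ^ 6 = x ^ 4 + x ^ 3 + 2 * x ^ 2 + x + 1"
    using x by auto
  have no: False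
    if a: "1 < a" "a < b" "a ^ 6 = a ^ 4 + a ^ 3 + 2 * a ^ 2 + a + 1"
      "b ^ 6 = b ^ 4 + b ^ 3 + 2 * b ^ 2 + b + 1" for a b :: real
  proof -
    let ?g = "\<lambda>y::real. y ^ 2 + y ^ 3 + 2 * y ^ 4 + y ^ 5 + y ^ 6"
    have g: "?g (1 / c) = 1"
      if "1 < c" "c ^ 6 = c ^ 4 + c ^ 3 + 2 * c ^ 2 + c + 1" for c :: real
    proof -
      have "?g (1 / c) = (c ^ 4 + c ^ 3 + 2 * c ^ 2 + c + 1) / c ^ 6"
        using that(1) by (simp add: field_simps eval_nat_numeral)
      then show ?thesis using that(1) by (simp flip: that(2))
    qed
    have lt: "(1 / b) ^ n < (1 / a) ^ n" if "0 < n" for n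
      using a that by (intro power_strict_mono) (auto simp: field_simps)
    have "?g (1 / b) < ?g (1 / a)"
      using lt[of 2] lt[of 3] lt[of 4] lt[of 5] lt[of 6] by linarith
    then show False using g[of a] g[of b] a by linarith
  qed
  show ?thesis
  proof (rule ex1I[of _ x], rule ex)
    fix y :: real
    assume y: "1 < y \<and> y < 2 \<and> y ^ 6 = y ^ 4 + y ^ 3 + 2 * y ^ 2 + y + 1"
    show "y = x" using no[of x y] no[of y x] ex y by (meson linorder_neqE_linordered_idom)
  qed
qed

end

theory Submission
  imports Defs
begin

text \<open>
  A point \<open>x\<close> has an expansion starting with the digit \<open>d\<close> exactly when its child \<open>q * x - d\<close> lies
  in \<open>[0, t]\<close>, where \<open>t = 1 / (q - 1)\<close>. So the expansions of \<open>x\<close> are the infinite paths of a tree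
  that branches at the points of the switch region \<open>1 \<le> q * z \<le> t\<close>. If below every node with several
  expansions there is a node whose two children both have several expansions, a diagonal argument
  shows that a point has either at most one expansion or uncountably many
  (\<open>uncountable_if_always_splits\<close>). It remains to exclude a node with several expansions below which
  every branching cuts off a single expansion, so that the branchings lie on one spine.

  Consider such a spine at one of its switch points \<open>z\<close>. The symmetry \<open>x \<mapsto> t - x\<close>, which exchanges the
  digits, allows the assumption that the child \<open>u = q * z - 1\<close> has one expansion; the spine then
  continues through \<open>1 + u\<close>. Call \<open>u\<close> an offset. Unique expansions are very rigid for bases only
  slightly above the golden ratio: an orbit in \<open>[0, t]\<close> that avoids the switch region ends in one of the fixed
  points \<open>0\<close> and \<open>t\<close> or in the cycle of
  \<open>c = 1 / (q\<^sup>2 - 1)\<close> and \<open>q * c\<close>, whose digits alternate. Hence an offset is \<open>0\<close> or \<open>c / q ^ m\<close> with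
  \<open>m \<ge> 1\<close> (\<open>offset_forms\<close>).

  Now follow the spine from \<open>1 + u\<close> to the next switch point. It yields a new offset, and which one is
  determined by \<open>u\<close>, as the alternative (the one where the other child is cut off) falls strictly
  between consecutive values \<open>c / q ^ m\<close>. With \<open>e = q\<^sup>2 - q - 1\<close>, which is positive and below
  \<open>0.0634\<close>:

  \<^item> if \<open>u\<close> is small, meaning \<open>0\<close> or \<open>c / q ^ m\<close> with \<open>m \<ge> 3\<close>, the new offset is \<open>e + q\<^sup>2 * u\<close>;
  \<^item> if \<open>u = c / q\<^sup>2\<close>, it is \<open>e * (q - c)\<close>; if \<open>u = c / q\<close>, it is \<open>e * (q\<^sup>2 - c)\<close>.

  The critical base enters in the first case: the alternative is \<open>t - 1 - e - q\<^sup>2 * u\<close>, and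
  at \<open>q_aleph0\<close> this takes the admissible value \<open>c / q\<close> for \<open>u = c / q ^ 5\<close>, and \<open>c / q ^ 3\<close> for
  \<open>u = c / q ^ 3\<close>. In all cases the new offset exceeds \<open>0\<close> or some \<open>c / q ^ m\<close> by so little that
  it cannot be \<open>c / q\<close> or \<open>c / q\<^sup>2\<close>; so it is small again. But from a small
  offset \<open>v\<close>, two steps lead to \<open>w = e + q\<^sup>2 * v \<ge> e\<close> and then to \<open>e + q\<^sup>2 * w\<close>, which is at most
  \<open>(q\<^sup>2 + 1) * w\<close>. As \<open>q\<^sup>2 + 1 < q ^ 3\<close>, it lies strictly between \<open>q\<^sup>2 * w\<close> and \<open>q ^ 3 * w\<close>,
  hence between two consecutive values \<open>c / q ^ m\<close>. This is a contradiction, so there are no offsets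
  (\<open>no_offset\<close>).
\<close>

section \<open>Expansions and orbits\<close>

locale expansion_base =
  fixes q :: real
  assumes q_gt_1: "1 < q" and q_less_2: "q < 2"
begin

definition t :: real where "t = 1 / (q - 1)"

lemma t_gt_1: "1 < t" and q_mult_t: "q * t = t + 1"
  using q_gt_1 q_less_2 by (auto simp: t_def field_simps)

lemma q_expansion_Suc:
  "q_expansion q x \<epsilon> \<longleftrightarrow>
     \<epsilon> 0 \<in> {0, 1} \<and> q_expansion q (q * x - real (\<epsilon> 0)) (\<lambda>i. \<epsilon> (Suc i))"
proof -
  have "range \<epsilon> = \<epsilon> ` insert 0 (range Suc)"
    by (metis UNIV_eq_I insertI1 insertI2 not0_implies_Suc rangeI)
  then have "range \<epsilon> = insert (\<epsilon> 0) (range (\<lambda>i. \<epsilon> (Suc i)))"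
    by (simp add: image_image)
  then have r: "range \<epsilon> \<subseteq> {0, 1} \<longleftrightarrow> \<epsilon> 0 \<in> {0, 1} \<and> range (\<lambda>i. \<epsilon> (Suc i)) \<subseteq> {0, 1}"
    by simp
  have "(\<lambda>i. real (\<epsilon> i) / q ^ Suc i) sums x \<longleftrightarrow>
      (\<lambda>i. real (\<epsilon> (Suc i)) / q ^ Suc (Suc i)) sums (x - real (\<epsilon> 0) / q)"
    by (subst sums_Suc_iff) simp
  also have "\<dots> \<longleftrightarrow> (\<lambda>i. q * (real (\<epsilon> (Suc i)) / q ^ Suc (Suc i))) sums (q * (x - real (\<epsilon> 0) / q))"
    using q_gt_1 by (subst sums_mult_iff) auto
  also have "(\<lambda>i. q * (real (\<epsilon> (Suc i)) / q ^ Suc (Suc i))) = (\<lambda>i. real (\<epsilon> (Suc i)) / q ^ Suc i)"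
    using q_gt_1 by (auto simp: field_simps)
  also have "q * (x - real (\<epsilon> 0) / q) = q * x - real (\<epsilon> 0)"
    using q_gt_1 by (simp add: field_simps)
  finally show ?thesis
    by (simp only: q_expansion_def r conj_assoc)
qed

lemma geometric_sums_t: "(\<lambda>i. 1 / q ^ Suc i) sums t"
proof -
  have "(\<lambda>i. (1 / q) * (1 / q) ^ i) sums ((1 / q) * (1 / (1 - 1 / q)))"
    using q_gt_1 by (intro sums_mult geometric_sums) auto
  then show ?thesis using q_gt_1 by (simp add: t_def field_simps)
qed

lemma q_expansion_bounds:
  assumes "q_expansion q x \<epsilon>"
  shows "0 \<le> x" "x \<le> t"
proof -
  have s: "(\<lambda>i. real (\<epsilon> i) / q ^ Suc i) sums x" and d: "\<epsilon> i \<le> 1" for i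
    using assms by (auto simp: q_expansion_def image_subset_iff dest: spec[of _ i])
  show "0 \<le> x"
    using q_gt_1 by (intro sums_le[OF _ sums_zero s]) auto
  show "x \<le> t"
    using q_gt_1 d by (intro sums_le[OF _ s geometric_sums_t]) (auto intro!: divide_right_mono)
qed

text \<open>The partial sums of the expansion differ from \<open>x\<close> by \<open>y n / q ^ n\<close>, which tends to \<open>0\<close> when the
  orbit \<open>y\<close> stays bounded.\<close>

lemma q_expansion_of_bounded_orbit:
  assumes "y 0 = x" and y: "\<And>n. y (Suc n) = q * y n - real (\<epsilon> n)"
    and d: "\<And>n. \<epsilon> n \<in> {0, 1}" and b: "\<And>n. 0 \<le> y n" "\<And>n. y n \<le> t"
  shows "q_expansion q x \<epsilon>"
proof -
  have "y n / q ^ n = real (\<epsilon> n) / q ^ Suc n + y (Suc n) / q ^ Suc n" for n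
    using q_gt_1 by (simp add: y field_simps)
  then have part: "(\<Sum>i<n. real (\<epsilon> i) / q ^ Suc i) = x - y n / q ^ n" for n
    by (induction n) (simp_all add: assms(1))
  have "(\<lambda>n. t * (1 / q) ^ n) \<longlonglongrightarrow> t * 0"
    using q_gt_1 by (intro tendsto_mult_left LIMSEQ_realpow_zero) auto
  then have lim0: "(\<lambda>n. t / q ^ n) \<longlonglongrightarrow> 0" by (simp add: field_simps)
  have "(\<lambda>n. y n / q ^ n) \<longlonglongrightarrow> 0"
    using q_gt_1 b
    by (intro tendsto_sandwich[OF _ _ tendsto_const lim0] always_eventually allI)
      (simp, intro divide_right_mono, auto)
  then have "(\<lambda>n. x - y n / q ^ n) \<longlonglongrightarrow> x - 0"
    by (intro tendsto_diff tendsto_const)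
  then show ?thesis
    unfolding q_expansion_def sums_def part using d by (simp add: image_subset_iff)
qed

text \<open>The greedy algorithm: its orbit stays in \<open>[0, t]\<close> because \<open>q * t = t + 1\<close> and \<open>1 < t\<close>.\<close>

lemma q_expansion_exists:
  assumes "0 \<le> x" "x \<le> t"
  shows "\<exists>\<epsilon>. q_expansion q x \<epsilon>"
proof -
  define T where "T y = (if 1 \<le> q * y then q * y - 1 else q * y)" for y
  have step: "0 \<le> T y \<and> T y \<le> t" if "0 \<le> y" "y \<le> t" for y
  proof -
    have "q * y \<le> t + 1" "0 \<le> q * y"
      using that q_mult_t q_gt_1 mult_left_mono[of y t q] by auto
    then show ?thesis using t_gt_1 by (auto simp: T_def)
  qed
  have b: "0 \<le> (T ^^ n) x \<and> (T ^^ n) x \<le> t" for n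
    by (induction n) (use assms step in auto)
  show ?thesis
    using b by (intro exI[of _ "\<lambda>n. if 1 \<le> q * (T ^^ n) x then 1 else 0"]
        q_expansion_of_bounded_orbit[of "\<lambda>n. (T ^^ n) x"]) (auto simp: T_def[of "(T ^^ _) x"])
qed

definition multiple :: "real \<Rightarrow> bool" where
  "multiple x \<longleftrightarrow> (\<exists>\<epsilon> \<delta>. q_expansion q x \<epsilon> \<and> q_expansion q x \<delta> \<and> \<epsilon> \<noteq> \<delta>)"

lemma multiple_bounds: "multiple x \<Longrightarrow> 0 \<le> x" "multiple x \<Longrightarrow> x \<le> t"
  using q_expansion_bounds unfolding multiple_def by blast+

lemma not_multiple_iff:
  assumes "0 \<le> x" "x \<le> t"
  shows "\<not> multiple x \<longleftrightarrow> (\<exists>!\<epsilon>. q_expansion q x \<epsilon>)"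
  using q_expansion_exists[OF assms] unfolding multiple_def by blast

lemma q_expansion_Cons:
  assumes "d \<in> {0, 1}" "q_expansion q (q * x - real d) \<epsilon>"
  shows "q_expansion q x (case_nat d \<epsilon>)"
  using assms by (subst q_expansion_Suc) simp

lemma multiple_if_child:
  assumes "d \<in> {0, 1}" "multiple (q * x - real d)"
  shows "multiple x"
proof -
  obtain \<epsilon> \<delta> where *: "q_expansion q (q * x - real d) \<epsilon>" "q_expansion q (q * x - real d) \<delta>" "\<epsilon> \<noteq> \<delta>"
    using assms(2) by (auto simp: multiple_def)
  then obtain n where "case_nat d \<epsilon> (Suc n) \<noteq> case_nat d \<delta> (Suc n)"
    by auto
  then have "case_nat d \<epsilon> \<noteq> case_nat d \<delta>"
    by metis
  then show ?thesis
    using q_expansion_Cons[OF assms(1)] * unfolding multiple_def by blast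
qed

lemma multiple_if_switch:
  assumes "1 \<le> q * z" "q * z \<le> t"
  shows "multiple z"
proof -
  obtain \<epsilon> \<delta> where *: "q_expansion q (q * z - real 0) \<epsilon>" "q_expansion q (q * z - real 1) \<delta>"
    using q_expansion_exists[of "q * z"] q_expansion_exists[of "q * z - 1"] assms by auto
  have "case_nat 0 \<epsilon> \<noteq> case_nat 1 \<delta>"
    by (metis nat.case(1) zero_neq_one)
  then show ?thesis
    using q_expansion_Cons[OF _ *(1)] q_expansion_Cons[OF _ *(2)] unfolding multiple_def by blast
qed

text \<open>The point that is left to be expanded once the digits \<open>ds\<close> have been read off from \<open>x\<close>; it need not lie in
  \<open>[0, t]\<close>.\<close>

definition node :: "real \<Rightarrow> nat list \<Rightarrow> real" where
  "node x ds = foldl (\<lambda>y d. q * y - real d) x ds"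

lemma node_simps [simp]:
  "node x [] = x" "node x (d # ds) = node (q * x - real d) ds"
  "node x (ds @ es) = node (node x ds) es"
  by (simp_all add: node_def)

lemma node_bounds_backwards:
  assumes "set ds \<subseteq> {0, 1}" "0 \<le> node x ds" "node x ds \<le> t"
  shows "0 \<le> x \<and> x \<le> t"
  using assms
proof (induction ds arbitrary: x)
  case (Cons d ds)
  then have d: "d \<in> {0, 1}" "0 \<le> q * x - real d" "q * x - real d \<le> t"
    using Cons.IH[of "q * x - real d"] by simp_all
  then have "0 \<le> q * x" "q * x \<le> q * t" using q_mult_t t_gt_1 by auto
  then show ?case
    using q_gt_1 mult_le_cancel_left_pos[of q x t] zero_le_mult_iff[of q x] by linarith
qed auto

text \<open>Two expansions of \<open>x\<close> agree up to a first difference; the node there has both its children in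
  \<open>[0, t]\<close>.\<close>

lemma multiple_reaches_switch:
  assumes "multiple x"
  obtains ds where "set ds \<subseteq> {0, 1}" "1 \<le> q * node x ds" "q * node x ds \<le> t"
proof -
  obtain \<epsilon> \<delta> where e: "q_expansion q x \<epsilon>" "q_expansion q x \<delta>" and "\<epsilon> \<noteq> \<delta>"
    using assms by (auto simp: multiple_def)
  then obtain n where "\<epsilon> n \<noteq> \<delta> n" by auto
  then have "\<exists>ds. set ds \<subseteq> {0, 1} \<and> 1 \<le> q * node x ds \<and> q * node x ds \<le> t"
    using e
  proof (induction n arbitrary: x \<epsilon> \<delta> rule: less_induct)
    case (less n x \<epsilon> \<delta>)
    note e = less.prems(2,3)[unfolded q_expansion_Suc[of x]]
    show ?case
    proof (cases "\<epsilon> 0 = \<delta> 0")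
      case True
      then obtain m where m: "n = Suc m" using less.prems(1) by (cases n) auto
      have "\<exists>ds. set ds \<subseteq> {0, 1} \<and> 1 \<le> q * node (q * x - real (\<epsilon> 0)) ds
          \<and> q * node (q * x - real (\<epsilon> 0)) ds \<le> t"
        using less.IH[of m "\<lambda>i. \<epsilon> (Suc i)" "\<lambda>i. \<delta> (Suc i)" "q * x - real (\<epsilon> 0)"]
          less.prems(1) e True m by auto
      then obtain ds where "set ds \<subseteq> {0, 1}" "1 \<le> q * node (q * x - real (\<epsilon> 0)) ds"
          "q * node (q * x - real (\<epsilon> 0)) ds \<le> t" by blast
      then show ?thesis using e by (intro exI[of _ "\<epsilon> 0 # ds"]) auto
    next
      case False
      then have "1 \<le> q * x \<and> q * x \<le> t"
        using e q_expansion_bounds[of "q * x - real (\<epsilon> 0)"]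
          q_expansion_bounds[of "q * x - real (\<delta> 0)"] by fastforce
      then show ?thesis by (intro exI[of _ "[]"]) auto
    qed
  qed
  then show ?thesis using that by blast
qed

text \<open>If \<open>x\<close> does not split, then at every branching below \<open>x\<close> one of the two subtrees is a single path. Hence
  the failure to split is inherited by all nodes below \<open>x\<close>.\<close>

definition splits :: "real \<Rightarrow> bool" where
  "splits x \<longleftrightarrow> (\<exists>ds. set ds \<subseteq> {0, 1} \<and> multiple (node x (ds @ [0])) \<and> multiple (node x (ds @ [1])))"

lemma splits_if_child:
  assumes "d \<in> {0, 1}" "splits (q * x - real d)"
  shows "splits x"
proof -
  obtain ds where "set ds \<subseteq> {0, 1}" "multiple (node (q * x - real d) (ds @ [0]))"
      "multiple (node (q * x - real d) (ds @ [1]))"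
    using assms(2) unfolding splits_def by blast
  then show ?thesis unfolding splits_def using assms(1) by (intro exI[of _ "d # ds"]) auto
qed

lemma splits_if_node:
  assumes "set ds \<subseteq> {0, 1}" "splits (node x ds)"
  shows "splits x"
  using assms
proof (induction ds arbitrary: x)
  case (Cons d ds)
  have "set ds \<subseteq> {0, 1}" "splits (node (q * x - real d) ds)" using Cons.prems by simp_all
  then have "splits (q * x - real d)" by (rule Cons.IH)
  moreover have "d \<in> {0, 1}" using Cons.prems(1) by simp
  ultimately show ?case using splits_if_child by blast
qed simp

text \<open>Cantor's diagonal argument: given a list of expansions, grow a prefix whose node always keeps several
  expansions, and at each of its extensions use a split to deviate from the next expansion
  in the list. The limit is an expansion because its orbit is bounded.\<close>

lemma uncountable_if_always_splits:
  assumes split: "\<And>y. multiple y \<Longrightarrow> splits y" and "multiple x"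
  shows "uncountable (q_expansions q x)"
proof
  assume "countable (q_expansions q x)"
  moreover have "q_expansions q x \<noteq> {}"
    using assms(2) by (auto simp: multiple_def q_expansions_def)
  ultimately have range_e: "range (from_nat_into (q_expansions q x)) = q_expansions q x"
    by (rule range_from_nat_into[rotated])
  define e where "e = from_nat_into (q_expansions q x)"
  define P where "P ds \<longleftrightarrow> set ds \<subseteq> {0, 1} \<and> multiple (node x ds)" for ds
  define R where "R n ds ds' \<longleftrightarrow>
      (\<exists>es. ds' = ds @ es \<and> es \<noteq> []) \<and> (\<exists>i<length ds'. ds' ! i \<noteq> e n i)" for n ds ds'
  have "\<exists>f. \<forall>n. P (f n) \<and> R n (f n) (f (Suc n))"
  proof (rule dependent_nat_choice)
    show "\<exists>ds. P ds"
      using assms(2) by (intro exI[of _ "[]"]) (simp add: P_def)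
    fix ds n
    assume "P ds"
    then have ds: "set ds \<subseteq> {0, 1}" "multiple (node x ds)" by (simp_all add: P_def)
    then obtain es where es: "set es \<subseteq> {0, 1}" "multiple (node x (ds @ es @ [0]))"
        "multiple (node x (ds @ es @ [1]))"
      using split[OF ds(2)] unfolding splits_def by auto
    \<comment> \<open>both digits may follow \<open>ds @ es\<close>, so the one that \<open>e n\<close> does not have there is available\<close>
    define d :: nat where "d = (if e n (length (ds @ es)) = 0 then 1 else 0)"
    have d: "d \<noteq> e n (length (ds @ es))" "d \<in> {0, 1}" by (auto simp: d_def)
    then have "multiple (node x (ds @ es @ [d]))" using es by blast
    then have "P (ds @ es @ [d])" using ds es d by (auto simp: P_def)
    moreover have "R n ds (ds @ es @ [d])"
      using d(1) by (auto simp: R_def nth_append intro!: exI[of _ "length ds + length es"])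
    ultimately show "\<exists>ds'. P ds' \<and> R n ds ds'" by blast
  qed
  then obtain f where f: "\<And>n. set (f n) \<subseteq> {0, 1}" "\<And>n. multiple (node x (f n))"
    and ext: "\<And>n. \<exists>es. f (Suc n) = f n @ es \<and> es \<noteq> []"
    and diff: "\<And>n. \<exists>i<length (f (Suc n)). f (Suc n) ! i \<noteq> e n i"
    unfolding P_def R_def by blast
  have len: "n \<le> length (f n)" for n
  proof (induction n)
    case (Suc n)
    then show ?case using ext[of n] by (auto simp: Suc_le_eq length_greater_0_conv intro: le_less_trans)
  qed simp
  have mono: "\<exists>es. f (n + k) = f n @ es" for n k
    by (induction k) (use ext in \<open>auto, metis append_assoc\<close>)
  define \<epsilon> where "\<epsilon> i = f (Suc i) ! i" for i
  have \<epsilon>_nth: "f n ! i = \<epsilon> i" if i: "i < length (f n)" for n i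
  proof -
    have i': "i < length (f (Suc i))" using len[of "Suc i"] by simp
    obtain es es' where "f (n + Suc i) = f n @ es" "f (Suc i + n) = f (Suc i) @ es'"
      using mono by blast
    then have "f n @ es = f (Suc i) @ es'" by (simp add: add.commute)
    then show ?thesis using i i' unfolding \<epsilon>_def by (metis nth_append)
  qed
  have take_f: "take n (f n) = map \<epsilon> [0..<n]" for n
    using len[of n] by (intro nth_equalityI) (auto simp: \<epsilon>_nth)
  have "q_expansion q x \<epsilon>"
  proof (rule q_expansion_of_bounded_orbit[of "\<lambda>n. node x (map \<epsilon> [0..<n])"])
    fix n
    show "\<epsilon> n \<in> {0, 1}"
      using f(1)[of "Suc n"] len[of "Suc n"] unfolding \<epsilon>_def by (meson Suc_le_lessD nth_mem subsetD)
    \<comment> \<open>the node of a prefix is bounded because a node further down is\<close>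
    have split_f: "f n = map \<epsilon> [0..<n] @ drop n (f n)"
      by (metis append_take_drop_id take_f)
    have "node x (f n) = node (node x (map \<epsilon> [0..<n])) (drop n (f n))"
      by (subst split_f) simp
    moreover have "set (drop n (f n)) \<subseteq> {0, 1}"
      using f(1)[of n] set_drop_subset[of n "f n"] by blast
    ultimately have "0 \<le> node x (map \<epsilon> [0..<n]) \<and> node x (map \<epsilon> [0..<n]) \<le> t"
      using node_bounds_backwards multiple_bounds[OF f(2)[of n]] by metis
    then show "0 \<le> node x (map \<epsilon> [0..<n])" "node x (map \<epsilon> [0..<n]) \<le> t" by auto
  qed auto
  then obtain n where "e n = \<epsilon>"
    using range_e unfolding e_def q_expansions_def by (metis (mono_tags) mem_Collect_eq rangeE)
  then show False using diff[of n] \<epsilon>_nth[of _ "Suc n"] by auto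
qed

text \<open>Exchanging the digits \<open>0\<close> and \<open>1\<close> reflects \<open>x\<close> to \<open>t - x\<close>, because all digits \<open>1\<close> expand \<open>t\<close>. So one may
  choose which child of a switch point is cut off.\<close>

lemma q_expansion_reflect:
  assumes "q_expansion q x \<epsilon>"
  shows "q_expansion q (t - x) (\<lambda>i. 1 - \<epsilon> i)"
proof -
  have d: "\<epsilon> i \<le> 1" for i
    using assms by (auto simp: q_expansion_def image_subset_iff dest: spec[of _ i])
  have "(\<lambda>i. 1 / q ^ Suc i - real (\<epsilon> i) / q ^ Suc i) sums (t - x)"
    using assms geometric_sums_t unfolding q_expansion_def by (intro sums_diff) auto
  also have "(\<lambda>i. 1 / q ^ Suc i - real (\<epsilon> i) / q ^ Suc i) = (\<lambda>i. real (1 - \<epsilon> i) / q ^ Suc i)"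
    using d by (auto simp: of_nat_diff diff_divide_distrib)
  finally show ?thesis unfolding q_expansion_def by (auto simp: image_subset_iff)
qed

lemma multiple_reflect:
  assumes "multiple x"
  shows "multiple (t - x)"
proof -
  obtain \<epsilon> \<delta> where e: "q_expansion q x \<epsilon>" "q_expansion q x \<delta>" and "\<epsilon> \<noteq> \<delta>"
    using assms by (auto simp: multiple_def)
  then obtain n where n: "\<epsilon> n \<noteq> \<delta> n" by auto
  have "\<epsilon> n \<le> 1" "\<delta> n \<le> 1"
    using e by (auto simp: q_expansion_def image_subset_iff dest: spec[of _ n])
  then have "(\<lambda>i. 1 - \<epsilon> i) \<noteq> (\<lambda>i. 1 - \<delta> i)"
    using n by (metis diff_diff_cancel)
  then show ?thesis using e[THEN q_expansion_reflect] unfolding multiple_def by blast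
qed

lemma node_reflect:
  assumes "set ds \<subseteq> {0, 1}"
  shows "node (t - x) (map (\<lambda>d. 1 - d) ds) = t - node x ds"
  using assms
proof (induction ds arbitrary: x)
  case (Cons d ds)
  then have "q * (t - x) - real (1 - d) = t - (q * x - real d)"
    using q_mult_t by (auto simp: algebra_simps)
  then show ?case using Cons by simp
qed simp

lemma splits_reflect:
  assumes "splits x"
  shows "splits (t - x)"
proof -
  obtain ds where ds: "set ds \<subseteq> {0, 1}" "multiple (node x (ds @ [0]))" "multiple (node x (ds @ [1]))"
    using assms by (auto simp: splits_def)
  then have "multiple (node (t - x) (map (\<lambda>d. 1 - d) (ds @ [0])))"
      "multiple (node (t - x) (map (\<lambda>d. 1 - d) (ds @ [1])))"
    by (subst node_reflect; force intro!: multiple_reflect)+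
  then show ?thesis
    unfolding splits_def by (intro exI[of _ "map (\<lambda>d. 1 - d) ds"]) auto
qed

section \<open>Spines that never split\<close>

text \<open>An offset \<open>u\<close> describes, up to reflection, the switch point \<open>(1 + u) / q\<close> on a spine: the child \<open>u\<close>
  is cut off with its only expansion, and the spine goes on through the other child, \<open>1 + u\<close>.\<close>

definition offset :: "real \<Rightarrow> bool" where
  "offset u \<longleftrightarrow> 0 \<le> u \<and> u \<le> t - 1 \<and> \<not> multiple u \<and> \<not> splits (1 + u)"

text \<open>One of the two children \<open>q * z - 1\<close> and \<open>q * z\<close> has a single expansion, or \<open>z\<close> itself would split. If it
  is the second one, the reflected point \<open>t - q * z\<close> is the offset, and \<open>1 + (t - q * z)\<close> is the reflection of
  \<open>q * z - 1\<close>.\<close>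

lemma offset_if_switch:
  assumes "1 \<le> q * z" "q * z \<le> t" "\<not> splits z"
  shows "offset (q * z - 1) \<or> offset (t - q * z)"
proof -
  have nb: "\<not> splits (q * z)" "\<not> splits (q * z - 1)"
    using splits_if_child[of 0 z] splits_if_child[of 1 z] assms(3) by auto
  have "\<not> multiple (q * z) \<or> \<not> multiple (q * z - 1)"
    using assms(3) unfolding splits_def by (auto dest: spec[of _ "[]"])
  then show ?thesis
  proof
    assume "\<not> multiple (q * z - 1)"
    then have "offset (q * z - 1)" using assms nb by (simp add: offset_def)
    then show ?thesis ..
  next
    assume "\<not> multiple (q * z)"
    then have "\<not> multiple (t - q * z)" using multiple_reflect[of "t - q * z"] by auto
    moreover have "\<not> splits (1 + (t - q * z))"
      using splits_reflect[of "1 + (t - q * z)"] nb by auto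
    ultimately have "offset (t - q * z)" using assms by (simp add: offset_def)
    then show ?thesis ..
  qed
qed

lemma offset_if_multiple_not_splits:
  assumes "multiple y" "\<not> splits y"
  obtains u where "offset u"
proof -
  obtain ds where "set ds \<subseteq> {0, 1}" "1 \<le> q * node y ds" "q * node y ds \<le> t"
    using multiple_reaches_switch[OF assms(1)] .
  then show ?thesis using offset_if_switch[of "node y ds"] splits_if_node assms(2) that by blast
qed

lemma not_splits_child:
  assumes "\<not> splits x"
  shows "\<not> splits (q * x)" "\<not> splits (q * x - 1)"
  using splits_if_child[of 0 x] splits_if_child[of 1 x] assms by auto

end

section \<open>Bases above the golden ratio\<close>

text \<open>The first condition says that the base exceeds the golden ratio, which makes the switch region lie to the left of
  \<open>1\<close>. The second one says that \<open>q - 1\<close>, the child of \<open>1\<close> for the digit \<open>1\<close>, does not exceed the right end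
  of the switch region.\<close>

locale golden_base = expansion_base +
  assumes golden: "q + 1 < q\<^sup>2" and q_upper: "q * (q - 1)\<^sup>2 < 1"
begin

text \<open>The points \<open>c\<close> and \<open>q * c\<close> have the alternating digits that start with \<open>0\<close> and \<open>1\<close>, respectively. The defect
  \<open>e\<close> of the golden ratio equation measures how far the base is from the golden ratio.\<close>

definition c :: real where "c = 1 / (q\<^sup>2 - 1)"
definition e :: real where "e = q\<^sup>2 - q - 1"

lemma c_pos: "0 < c" and t_eq: "t = (q + 1) * c" and c_less: "c < 1 / q"
  and c_eq: "q\<^sup>2 * c = 1 + c" and c_gt: "t - 1 < c"
proof -
  have q2: "q\<^sup>2 - 1 = (q - 1) * (q + 1)" by (simp add: power2_eq_square algebra_simps)
  show "0 < c" using golden q_gt_1 by (simp add: c_def)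
  show t: "t = (q + 1) * c" using q_gt_1 unfolding t_def c_def q2 by simp
  show "c < 1 / q" using golden q_gt_1 by (simp add: c_def t_def field_simps)
  show c: "q\<^sup>2 * c = 1 + c" using golden q_gt_1 by (simp add: c_def t_def field_simps)
  have "(q + 1) * c < q\<^sup>2 * c" using golden \<open>0 < c\<close> by (rule mult_strict_right_mono)
  then show "t - 1 < c" using t c by linarith
qed

lemma c_less_1: "c < 1"
proof -
  have "1 / q < 1" using q_gt_1 by simp
  then show ?thesis using c_less by linarith
qed

lemma q_mult_c: "q * c = 1 - c * e"
  using c_eq by (simp add: e_def algebra_simps)

text \<open>Both points of the cycle lie outside the switch region, so every digit is forced.\<close>

lemma two_cycle_not_multiple: "\<not> multiple (q * c)"
proof
  have gap1: "q * (q * c) > t" using c_eq c_gt by (simp add: power2_eq_square algebra_simps)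
  have gap2: "q * c < 1" using c_less q_gt_1 by (simp add: field_simps)
  have cyc: "q * (q * (q * c) - 1) - 0 = q * c" using c_eq by (simp add: power2_eq_square algebra_simps)
  have eq: "\<epsilon> n = (if even n then 1 else 0)" if "q_expansion q (q * c) \<epsilon>" for \<epsilon> n
    using that
  proof (induction n arbitrary: \<epsilon> rule: less_induct)
    case (less n)
    note a = less.prems[unfolded q_expansion_Suc[of "q * c"]]
    have 0: "\<epsilon> 0 = 1" using a q_expansion_bounds[of "q * (q * c) - real (\<epsilon> 0)"] gap1 by auto
    note b = a[unfolded 0 q_expansion_Suc[of "q * (q * c) - real 1"]]
    have 1: "\<epsilon> (Suc 0) = 0"
      using b q_expansion_bounds(1)[of "q * (q * (q * c) - real 1) - real (\<epsilon> (Suc 0))"] gap2 cyc by auto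
    have rest: "q_expansion q (q * c) (\<lambda>i. \<epsilon> (Suc (Suc i)))"
      using b unfolding 1 of_nat_0 of_nat_1 cyc by blast
    consider "n = 0" | "n = 1" | m where "n = Suc (Suc m)"
      by (metis One_nat_def not0_implies_Suc)
    then show ?case
    proof cases
      case 3
      then show ?thesis using less.IH[OF _ rest, of m] by simp
    qed (use 0 1 in auto)
  qed
  assume "multiple (q * c)"
  then obtain \<epsilon> \<delta> where "q_expansion q (q * c) \<epsilon>" "q_expansion q (q * c) \<delta>" "\<epsilon> \<noteq> \<delta>"
    by (auto simp: multiple_def)
  then show False using eq by (metis ext)
qed

lemma not_multiple_child:
  "\<not> multiple x \<Longrightarrow> \<not> multiple (q * x)" "\<not> multiple x \<Longrightarrow> \<not> multiple (q * x - 1)"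
  using multiple_if_child[of 0 x] multiple_if_child[of 1 x] by auto

text \<open>Between the switch region and \<open>1\<close>, a point that never meets the switch region must take the digit
  \<open>1\<close>, then the digit \<open>0\<close>, and is then back in the same gap. Two such steps multiply the distance from the fixed
  point \<open>q * c\<close> by \<open>q\<^sup>2\<close>, so this distance has to be \<open>0\<close>.\<close>

lemma upper_gap_not_multiple:
  assumes "t < q * v" "v < 1" "\<not> multiple v"
  shows "v = q * c"
proof (rule ccontr)
  assume "v \<noteq> q * c"
  define w where "w n = q * c + (q\<^sup>2) ^ n * (v - q * c)" for n
  have w_Suc: "w (Suc n) = q * (q * w n - 1)" for n
    using c_eq by (simp add: w_def power2_eq_square algebra_simps)
  have w: "t < q * w n \<and> w n < 1 \<and> \<not> multiple (w n)" for n
  proof (induction n)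
    case 0
    then show ?case using assms by (simp add: w_def)
  next
    case (Suc n)
    define a where "a = q * w n - 1"
    have a: "t - 1 < a" "a < q - 1" "\<not> multiple a"
      using Suc not_multiple_child(2)[of "w n"] q_gt_1 by (auto simp: a_def)
    \<comment> \<open>the lower half of the alternation: \<open>a\<close> cannot lie beyond the switch region, hence lies before it\<close>
    have "q * (q - 1) < t"
      using q_upper q_gt_1 by (simp add: t_def field_simps power2_eq_square)
    moreover have "q * a < q * (q - 1)" using a(2) q_gt_1 by (intro mult_strict_left_mono) simp_all
    ultimately have "q * a < t" by linarith
    then have "q * a < 1" using multiple_if_switch[of a] a(3) by linarith
    moreover have "t < q * (q * a)"
    proof -
      have "1 = (q - 1) * t" using q_gt_1 by (simp add: t_def)
      also have "\<dots> \<le> (q\<^sup>2 * (2 - q)) * t"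
        using q_upper q_gt_1 t_gt_1 by (intro mult_right_mono) (simp_all add: power2_eq_square algebra_simps)
      also have "\<dots> = q\<^sup>2 * ((2 - q) * t)" by (simp only: mult.assoc)
      also have "(2 - q) * t = t - 1" unfolding left_diff_distrib using q_mult_t by linarith
      also have "q\<^sup>2 * (t - 1) = q * (q * (t - 1))" by (simp add: power2_eq_square)
      also have "\<dots> \<le> q * (q * a)"
        using a(1) q_gt_1 by (intro mult_left_mono) auto
      finally show ?thesis
        using multiple_if_switch[of "q * a"] not_multiple_child(1)[OF a(3)] by linarith
    qed
    ultimately show ?case
      using not_multiple_child(1)[OF a(3)] by (simp add: w_Suc a_def)
  qed
  have "1 < q\<^sup>2" using golden q_gt_1 by linarith
  then obtain n where n: "1 / \<bar>v - q * c\<bar> < (q\<^sup>2) ^ n" using real_arch_pow by blast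
  then have "1 < (q\<^sup>2) ^ n * \<bar>v - q * c\<bar>" using \<open>v \<noteq> q * c\<close> by (simp add: field_simps)
  then have "1 < \<bar>w n - q * c\<bar>" by (simp add: w_def abs_mult)
  moreover have "0 < q * w n" using w[of n] t_gt_1 by linarith
  then have "0 < w n" using q_gt_1 by (simp add: zero_less_mult_iff)
  moreover have "0 < q * c" "q * c < 1" using c_pos c_less q_gt_1 by (simp_all add: field_simps)
  ultimately show False using w[of n] by linarith
qed

text \<open>For \<open>0 < u\<close>, read off only the digit \<open>0\<close>: the orbit \<open>q ^ n * u\<close> jumps over the switch region into
  the gap below \<open>1\<close>, where it can only arrive at \<open>q * c\<close>.\<close>

lemma offset_forms:
  assumes "offset u"
  obtains "u = 0" | m where "m \<ge> 1" "u = c / q ^ m"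
proof (cases "u = 0")
  case False
  then have u: "0 < u" "u \<le> t - 1" "\<not> multiple u" using assms by (auto simp: offset_def)
  have nm: "\<not> multiple (q ^ n * u)" for n
    by (induction n) (use u(3) not_multiple_child(1) in \<open>auto simp: mult.assoc\<close>)
  have ex: "\<exists>n. 1 \<le> q ^ n * u"
  proof -
    obtain n where "1 / u < q ^ n" using real_arch_pow[OF q_gt_1] by blast
    then show ?thesis using u by (intro exI[of _ n]) (simp add: field_simps)
  qed
  define n where "n = (LEAST n. 1 \<le> q ^ n * u)"
  have n: "1 \<le> q ^ n * u" unfolding n_def using ex by (rule LeastI_ex)
  have less: "q ^ k * u < 1" if "k < n" for k
    using not_less_Least[of k "\<lambda>n. 1 \<le> q ^ n * u"] that by (simp add: n_def)
  have u_c: "u < c" using u c_gt by linarith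
  have "q * u < q * (1 / q)"
    using u_c c_less q_gt_1 by (intro mult_strict_left_mono) linarith+
  then have "q ^ 1 * u < 1" using q_gt_1 by simp
  moreover have "u < q * u" using u(1) q_gt_1 by simp
  ultimately have "q ^ 0 * u < 1" "q ^ 1 * u < 1" by simp_all
  then have "\<not> (n = 0 \<or> n = 1)" using n by (metis not_le)
  then have "n \<noteq> 0" "n \<noteq> 1" by simp_all
  then obtain m where m: "n = Suc (Suc m)" by (metis One_nat_def not0_implies_Suc)
  define v where "v = q ^ Suc m * u"
  have "v < 1" using less[of "Suc m"] m by (simp add: v_def)
  moreover have "1 \<le> q * v" using n m by (simp add: v_def)
  moreover have "\<not> multiple v" unfolding v_def by (rule nm)
  ultimately have "v = q * c"
    using upper_gap_not_multiple[of v] multiple_if_switch[of v] by linarith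
  then have "q * (q ^ m * u) = q * c" by (simp add: v_def)
  then have "q ^ m * u = c" using q_gt_1 by simp
  then have "u = c / q ^ m" using q_gt_1 by (simp add: field_simps)
  moreover from this have "m \<noteq> 0" using u_c by (cases m) auto
  ultimately show ?thesis using that(2)[of m] by simp
qed (use that in blast)

end

section \<open>Bases below the critical value\<close>

text \<open>After division by the sixth power, the right-hand side becomes a polynomial in the reciprocal with nonnegative
  coefficients, which decreases in the base. The critical base satisfies the equation instead of the strict inequality,
  so it qualifies for \<open>b\<close> only if \<open>a\<close> is smaller.\<close>

lemma subcritical_mono:
  fixes a b :: real
  assumes "0 < a" "a \<le> b" "b ^ 6 < b ^ 4 + b ^ 3 + 2 * b ^ 2 + b + 1 \<or>
    a < b \<and> b ^ 6 = b ^ 4 + b ^ 3 + 2 * b ^ 2 + b + 1"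
  shows "a ^ 6 < a ^ 4 + a ^ 3 + 2 * a ^ 2 + a + 1"
proof -
  define h where "h y = y ^ 2 + y ^ 3 + 2 * y ^ 4 + y ^ 5 + y ^ 6" for y :: real
  have h: "h (1 / y) = (y ^ 4 + y ^ 3 + 2 * y ^ 2 + y + 1) / y ^ 6" if "0 < y" for y
    using that by (simp add: h_def field_simps eval_nat_numeral)
  have le: "(1 / b) ^ n \<le> (1 / a) ^ n" for n
    using assms by (intro power_mono) (auto simp: field_simps)
  have lt: "(1 / b) ^ 2 < (1 / a) ^ 2" if "a < b"
    using assms that by (intro power_strict_mono) (auto simp: field_simps)
  have "h (1 / b) \<le> h (1 / a)" "a < b \<Longrightarrow> h (1 / b) < h (1 / a)"
    using le[of 2] le[of 3] le[of 4] le[of 5] le[of 6] lt unfolding h_def by linarith+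
  moreover have "1 < h (1 / b) \<or> a < b \<and> 1 = h (1 / b)"
    using assms by (auto simp: h)
  ultimately have "1 < h (1 / a)" by auto
  then show ?thesis using assms(1) by (simp add: h)
qed

text \<open>The critical base is about \<open>1.64541\<close>.\<close>

lemma subcritical_less:
  fixes a :: real
  assumes "0 < a" "a ^ 6 < a ^ 4 + a ^ 3 + 2 * a ^ 2 + a + 1"
  shows "a < 1646 / 1000"
proof (rule ccontr)
  assume "\<not> a < 1646 / 1000"
  then have "(1646 / 1000) ^ 6 <
      (1646 / 1000) ^ 4 + (1646 / 1000) ^ 3 + 2 * (1646 / 1000) ^ 2 + 1646 / 1000 + (1 :: real)"
    by (intro subcritical_mono[of _ a]) (use assms in auto)
  then show False by (simp add: power_numeral_reduce)
qed

locale subcritical_base = golden_base +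
  assumes subcritical: "q ^ 6 < q ^ 4 + q ^ 3 + 2 * q ^ 2 + q + 1"
begin

lemma q_less: "q < 1646 / 1000"
  using subcritical_less subcritical q_gt_1 by simp

text \<open>The numerical bounds from here on compare quantities that are of the order of \<open>e\<close>, which vanishes at the
  golden ratio, with gaps between the values \<open>c / q ^ m\<close>, which do not. The inequality in which the critical base is
  sharp is not among them; it is in \<open>reflected_branch_bounds\<close>.\<close>

lemma inverse_q_less: "1 / q < 6181 / 10000"
proof -
  have "1618 / 1000 < q"
  proof (rule ccontr)
    assume "\<not> 1618 / 1000 < q"
    then have "q * (q - 1) \<le> (1618 / 1000) * (618 / 1000)" using q_gt_1 by (intro mult_mono) auto
    then show False using golden by (simp add: power2_eq_square algebra_simps)
  qed
  then show ?thesis by (simp add: field_simps)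
qed

lemma q2_less: "q\<^sup>2 < 27094 / 10000"
proof -
  have "q\<^sup>2 < (1646 / 1000)\<^sup>2" using q_less q_gt_1 by (intro power_strict_mono) auto
  then show ?thesis by (simp add: power2_eq_square)
qed

lemma c_gt_num: "585 / 1000 < c"
  using q2_less golden q_gt_1 by (simp add: c_def field_simps)

lemma e_bounds: "0 < e" "e < 634 / 10000"
proof -
  show "0 < e" using golden by (simp add: e_def)
  have "q * (q - 1) < (1646 / 1000) * (646 / 1000)" using q_less q_gt_1 by (intro mult_strict_mono) auto
  then show "e < 634 / 10000" by (simp add: e_def power2_eq_square algebra_simps)
qed

lemma e_q2_less: "e * q\<^sup>2 < 172 / 1000"
proof -
  have "e * q\<^sup>2 < (634 / 10000) * (27094 / 10000)" using e_bounds q2_less by (intro mult_strict_mono) auto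
  then show "e * q\<^sup>2 < 172 / 1000" by simp
qed

lemma c_div_pos: "0 < c / q ^ k"
  using c_pos q_gt_1 by simp

lemma c_div_q2_gt: "215 / 1000 < c / q\<^sup>2"
proof -
  have "(215 / 1000) * q\<^sup>2 < c" using q2_less c_gt_num by linarith
  then show ?thesis using q_gt_1 by (simp add: field_simps)
qed

text \<open>Adding \<open>e\<close> to an admissible value never reaches \<open>c / q\<^sup>2\<close> from below, nor \<open>c / q\<close> from
  \<open>c / q\<^sup>2\<close>.\<close>

lemma c_div_gap: "e < c / q\<^sup>2 - c / q ^ 3" "c / q\<^sup>2 - c / q ^ 3 < c / q - c / q\<^sup>2"
proof -
  define g where "g = c / q\<^sup>2 * (1 - 1 / q)"
  have eq: "c / q\<^sup>2 - c / q ^ 3 = g" "c / q - c / q\<^sup>2 = q * g"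
    using q_gt_1 by (simp_all add: g_def power2_eq_square power3_eq_cube field_simps)
  have "(215 / 1000) * (3819 / 10000) < g"
    unfolding g_def using c_div_q2_gt inverse_q_less c_div_pos[of 2] by (intro mult_strict_mono) auto
  then have g: "82 / 1000 < g" by simp
  then show "e < c / q\<^sup>2 - c / q ^ 3"
    unfolding eq using e_bounds(2) by linarith
  show "c / q\<^sup>2 - c / q ^ 3 < c / q - c / q\<^sup>2"
    unfolding eq using g q_gt_1 by simp
qed

lemma not_offset_between:
  assumes "c / q ^ Suc k < v" "v < c / q ^ k"
  shows "\<not> offset v"
proof
  assume "offset v"
  then show False
  proof (cases rule: offset_forms)
    case 1
    then show ?thesis using assms(1) c_div_pos[of "Suc k"] by linarith
  next
    case (2 m)
    have less_iff: "c / q ^ n < c / q ^ l \<longleftrightarrow> l < n" for n l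
    proof -
      have "c / q ^ n < c / q ^ l \<longleftrightarrow> c * (1 / q) ^ n < c * (1 / q) ^ l"
        by (simp add: power_divide)
      then show ?thesis using c_pos q_gt_1 by simp
    qed
    show ?thesis using assms unfolding 2 less_iff by linarith
  qed
qed

lemma not_offset_above:
  assumes "c / q < v"
  shows "\<not> offset v"
  using not_offset_between[of 0 v] assms c_gt by (auto simp: offset_def)

lemma reflected_branch_eq: "t - 1 - e = c * (q + 1 - (q\<^sup>2 - q) * (q\<^sup>2 - 1))"
proof -
  have "c * (q\<^sup>2 - 1) = 1" using golden q_gt_1 by (simp add: c_def)
  then have "(q\<^sup>2 - q) * (c * (q\<^sup>2 - 1)) = 1 + e" by (simp add: e_def)
  then show ?thesis unfolding t_eq by (simp add: algebra_simps)
qed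

text \<open>For a small offset \<open>u\<close>, the alternative to the next offset \<open>e + q\<^sup>2 * u\<close> is \<open>t - 1 - e - q\<^sup>2 * u\<close>. These
  bounds place it strictly between admissible values: \<open>q\<^sup>2 * u\<close> is \<open>c / q\<close> (second and first bound), or
  \<open>c / q\<^sup>2\<close> (second and third), or at most \<open>c / q ^ 3\<close> (first). The first bound is equivalent to
  the inequality that characterizes the bases below the critical one, and the second becomes an equality at the golden
  ratio.\<close>

lemma reflected_branch_bounds:
  "c / q + c / q ^ 3 < t - 1 - e" "t - 1 - e < c / q + c / q\<^sup>2" "2 * (c / q\<^sup>2) < t - 1 - e"
proof -
  define B where "B = q + 1 - (q\<^sup>2 - q) * (q\<^sup>2 - 1)"
  have "q ^ 3 * (B - (1 / q + 1 / q ^ 3)) = (q - 1) * (q ^ 4 + q ^ 3 + 2 * q ^ 2 + q + 1 - q ^ 6)"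
    using q_gt_1 by (simp add: B_def e_def field_simps eval_nat_numeral)
  also have "\<dots> > 0" using subcritical q_gt_1 by simp
  finally have 1: "1 / q + 1 / q ^ 3 < B" using q_gt_1 by (simp add: zero_less_mult_iff)
  have "q\<^sup>2 * (1 / q + 1 / q\<^sup>2 - B) = (q ^ 4 - 1) * e"
    using q_gt_1 by (simp add: B_def e_def field_simps eval_nat_numeral)
  also have "\<dots> > 0" using e_bounds q_gt_1 by (intro mult_pos_pos) auto
  finally have 2: "B < 1 / q + 1 / q\<^sup>2" using q_gt_1 by (simp add: zero_less_mult_iff)
  have "q\<^sup>2 * (B - 2 / q\<^sup>2) = q\<^sup>2 - 2 - q\<^sup>2 * (e * q\<^sup>2)"
    using q_gt_1 by (simp add: B_def e_def field_simps eval_nat_numeral)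
  also have "\<dots> > 0"
  proof -
    have "16 / 10 < q" using inverse_q_less q_gt_1 by (simp add: field_simps)
    moreover have "q\<^sup>2 * (e * q\<^sup>2) < 1 / 2"
    proof -
      have "q\<^sup>2 * (e * q\<^sup>2) \<le> (27094 / 10000) * (172 / 1000)"
        using q2_less e_q2_less e_bounds by (intro mult_mono) auto
      then show ?thesis by simp
    qed
    ultimately show ?thesis using golden by linarith
  qed
  finally have 3: "2 / q\<^sup>2 < B" using q_gt_1 by (simp add: zero_less_mult_iff)
  show "c / q + c / q ^ 3 < t - 1 - e" "t - 1 - e < c / q + c / q\<^sup>2" "2 * (c / q\<^sup>2) < t - 1 - e"
    using 1 2 3 c_pos mult_strict_left_mono[OF 1 c_pos] mult_strict_left_mono[OF 2 c_pos]
      mult_strict_left_mono[OF 3 c_pos]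
    unfolding reflected_branch_eq B_def[symmetric] by (simp_all add: distrib_left mult.commute)
qed

text \<open>From the remaining offsets \<open>c / q\<close> and \<open>c / q\<^sup>2\<close>, the spine takes the digit \<open>1\<close> more often before
  it meets the switch region.\<close>

definition small :: "real \<Rightarrow> bool" where
  "small u \<longleftrightarrow> u = 0 \<or> (\<exists>k. u = c / q ^ (k + 3))"

lemma offset_small_or_large:
  assumes "offset u"
  obtains "small u" | "u = c / q" | "u = c / q\<^sup>2"
  using assms
proof (cases rule: offset_forms)
  case (2 m)
  consider "m = (m - 3) + 3" | "m = 1" | "m = 2" using 2 by linarith
  then show ?thesis
  proof cases
    case 1
    then obtain k where "m = k + 3" by blast
    then show ?thesis using that(1) 2(2) unfolding small_def by blast
  qed (use that 2 in auto)
qed (use that in \<open>auto simp: small_def\<close>)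

lemma c_div_mono: "m \<ge> k \<Longrightarrow> c / q ^ m \<le> c / q ^ k"
  using c_pos q_gt_1 by (intro divide_left_mono power_increasing) auto

text \<open>The child \<open>z = q * (1 + u) - 1\<close> of \<open>1 + u\<close> is already in the switch region, because \<open>q\<^sup>2 * u \<le> c / q\<close>
  is small enough. Its child for the digit \<open>1\<close> is \<open>e + q\<^sup>2 * u\<close>.\<close>

lemma offset_step:
  assumes offset: "offset u" and small: "small u"
  shows "offset (e + q\<^sup>2 * u)"
proof -
  define z where "z = q * (1 + u) - 1"
  have nb: "\<not> splits z" using offset not_splits_child(2)[of "1 + u"] by (simp add: offset_def z_def)
  have z: "q * z = 1 + (e + q\<^sup>2 * u)" by (simp add: z_def e_def power2_eq_square algebra_simps)
  have u: "0 \<le> u" using offset by (simp add: offset_def)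
  have shift: "q\<^sup>2 * (c / q ^ (k + 3)) = c / q ^ (k + 1)" for k
    using q_gt_1 by (simp add: power_add power2_eq_square power3_eq_cube)
  have "q\<^sup>2 * u \<le> c / q ^ 1"
    using small unfolding small_def
  proof (elim disjE exE)
    fix k
    assume u_k: "u = c / q ^ (k + 3)"
    show ?thesis unfolding u_k shift by (rule c_div_mono) simp
  qed (use c_div_pos[of 1] in simp)
  moreover have "c / q ^ 1 < t - 1 - e"
    using reflected_branch_bounds(1) c_div_pos[of 3] by simp
  ultimately have "q * z \<le> t" using z by linarith
  moreover have "1 \<le> q * z" using z e_bounds u by simp
  moreover have "\<not> offset (t - q * z)"
  proof -
    have tz: "t - q * z = t - 1 - e - q\<^sup>2 * u" using z by simp
    show ?thesis
      using small unfolding small_def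
    proof (elim disjE exE)
      assume "u = 0"
      then show ?thesis using reflected_branch_bounds(1) c_div_pos[of 3] unfolding tz
        by (intro not_offset_above) simp
    next
      fix k
      assume u_k: "u = c / q ^ (k + 3)"
      consider "k = 0" | "k = 1" | "k + 1 \<ge> 3" by linarith
      then show ?thesis
      proof cases
        case 1
        then have "q\<^sup>2 * u = c / q" using shift[of k] u_k by simp
        then show ?thesis using reflected_branch_bounds(1,2) unfolding tz
          by (intro not_offset_between[of 2]) (simp_all add: numeral_3_eq_3)
      next
        case 2
        then have "q\<^sup>2 * u = c / q\<^sup>2" using shift[of k] u_k by (simp add: numeral_2_eq_2)
        then show ?thesis using reflected_branch_bounds(2,3) unfolding tz
          by (intro not_offset_between[of 1]) (simp_all add: numeral_2_eq_2)
      next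
        case 3
        then have "q\<^sup>2 * u \<le> c / q ^ 3" using shift[of k] c_div_mono[of 3 "k + 1"] u_k by simp
        then show ?thesis using reflected_branch_bounds(1) unfolding tz
          by (intro not_offset_above) linarith
      qed
    qed
  qed
  ultimately show ?thesis using offset_if_switch[of z] nb z by auto
qed

text \<open>A switch point whose child \<open>v\<close> is of the order of \<open>e\<close>: the alternative offset \<open>t - 1 - v\<close> exceeds \<open>c / q\<close>,
  the largest admissible value.\<close>

lemma offset_at_left_child:
  assumes "\<not> splits z" "q * z = 1 + v" "0 \<le> v" "v \<le> e * q\<^sup>2"
  shows "offset v"
proof -
  have "c * (q\<^sup>2 - 1) = 1" using golden q_gt_1 by (simp add: c_def)
  then have t1: "t - 1 - c / q = c * (1 - e - 1 / q)"
    unfolding t_eq e_def by (simp add: algebra_simps)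
  have "(585 / 1000) * (3185 / 10000) < c * (1 - e - 1 / q)"
    using c_gt_num inverse_q_less e_bounds by (intro mult_strict_mono) auto
  then have "172 / 1000 < c * (1 - e - 1 / q)" by (rule less_trans[rotated]) simp
  then have gap: "v < t - 1 - c / q" using assms(4) e_q2_less t1 by linarith
  moreover have "0 < c / q" using c_pos q_gt_1 by simp
  ultimately have "offset (q * z - 1) \<or> offset (t - q * z)"
    using assms by (intro offset_if_switch) linarith+
  moreover have "\<not> offset (t - q * z)" using gap assms(2) by (intro not_offset_above) linarith
  ultimately show ?thesis using assms(2) by simp
qed

lemma small_if_less:
  assumes "offset v" "v < c / q\<^sup>2"
  shows "small v"
  using assms(1)
proof (cases rule: offset_small_or_large)
  case 2
  then show ?thesis using assms(2) c_div_mono[of 1 2] by simp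
qed (use assms(2) in auto)

text \<open>From \<open>c / q\<close> the spine takes the digit \<open>1\<close> three times to reach the switch region at \<open>q * e + c\<close>, from
  \<open>c / q\<^sup>2\<close> it takes it twice to reach \<open>e + c\<close>. The offset that results is of the order of \<open>e\<close>, hence small.\<close>

lemma offset_reaches_small:
  assumes "offset u"
  obtains v where "offset v" "small v"
  using assms
proof (cases rule: offset_small_or_large)
  case 1
  then show ?thesis using that assms by blast
next
  case 2
  have "q * (q * (q * (1 + u) - 1) - 1) - 1 = q * e + (q\<^sup>2 * c - 1)"
    using q_gt_1 by (simp add: 2 e_def power2_eq_square algebra_simps)
  then have "\<not> splits (q * e + c)"
    using assms not_splits_child(2) c_eq unfolding offset_def by (metis add_diff_cancel_left')
  moreover have "q * (q * e + c) = 1 + e * (q\<^sup>2 - c)"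
    using q_mult_c by (simp add: power2_eq_square algebra_simps)
  moreover have "0 \<le> e * (q\<^sup>2 - c)" "e * (q\<^sup>2 - c) \<le> e * q\<^sup>2"
    using e_bounds c_pos c_less_1 golden q_gt_1 by (auto intro!: mult_left_mono mult_nonneg_nonneg)
  ultimately have "offset (e * (q\<^sup>2 - c))" using offset_at_left_child by blast
  moreover have "e * (q\<^sup>2 - c) < c / q\<^sup>2"
    using \<open>e * (q\<^sup>2 - c) \<le> e * q\<^sup>2\<close> e_q2_less c_div_q2_gt by linarith
  ultimately show ?thesis using that small_if_less by blast
next
  case 3
  have "q * (q * (1 + u) - 1) - 1 = e + c"
    using q_gt_1 by (simp add: 3 e_def power2_eq_square algebra_simps)
  then have "\<not> splits (e + c)"
    using assms not_splits_child(2) unfolding offset_def by metis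
  moreover have "q * (e + c) = 1 + e * (q - c)"
    using q_mult_c by (simp add: algebra_simps)
  moreover have "0 \<le> e * (q - c)" "e * (q - c) \<le> e * q\<^sup>2"
    using e_bounds c_pos c_less_1 golden q_gt_1 by (auto intro!: mult_left_mono mult_nonneg_nonneg)
  ultimately have "offset (e * (q - c))" using offset_at_left_child by blast
  moreover have "e * (q - c) < c / q\<^sup>2"
    using \<open>e * (q - c) \<le> e * q\<^sup>2\<close> e_q2_less c_div_q2_gt by linarith
  ultimately show ?thesis using that small_if_less by blast
qed

text \<open>For \<open>u = 0\<close> the new offset is only \<open>e\<close>. For \<open>u = c / q ^ m\<close> it lies slightly above \<open>c / q ^ (m - 2)\<close>. The large offset \<open>c / q\<^sup>2\<close> is too far away
  when \<open>m \<ge> 5\<close>, and so is \<open>c / q\<close>. For \<open>m = 4\<close> and \<open>m = 3\<close> the new value misses the admissible ones, so that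
  these \<open>u\<close> are no offsets.\<close>

lemma small_step:
  assumes "offset u" "small u"
  shows "small (e + q\<^sup>2 * u)"
proof -
  have offset: "offset (e + q\<^sup>2 * u)" using offset_step assms by blast
  consider "u = 0" | k where "u = c / q ^ Suc (Suc (Suc k))"
    using assms(2) by (auto simp: small_def numeral_3_eq_3)
  then show ?thesis
  proof cases
    case 1
    have "e \<le> e * q\<^sup>2" using e_bounds q_gt_1 by (simp add: mult_le_cancel_left1)
    then have "e < c / q\<^sup>2" using e_q2_less c_div_q2_gt by linarith
    then show ?thesis using small_if_less[OF offset] 1 by simp
  next
    case (2 k)
    then have qu: "q\<^sup>2 * u = c / q ^ Suc k" using q_gt_1 by (simp add: power2_eq_square)
    consider "k = 0" | "k = 1" | "k \<ge> 2" by linarith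
    then show ?thesis
    proof cases
      case 1
      then show ?thesis using offset not_offset_above[of "e + q\<^sup>2 * u"] qu e_bounds by simp
    next
      case 2
      then have "c / q\<^sup>2 < e + q\<^sup>2 * u" "e + q\<^sup>2 * u < c / q"
        using qu e_bounds c_div_gap by (simp_all add: power2_eq_square)
      then show ?thesis using offset not_offset_between[of 1 "e + q\<^sup>2 * u"] by (simp add: power2_eq_square)
    next
      case 3
      then have "q\<^sup>2 * u \<le> c / q ^ 3" using c_div_mono[of 3 "Suc k"] qu by simp
      then show ?thesis using c_div_gap(1) by (intro small_if_less[OF offset]) linarith
    qed
  qed
qed

text \<open>A second small step multiplies the offset \<open>w\<close> by a factor that is larger than \<open>q\<^sup>2\<close> and, since \<open>e \<le> w\<close>, at most
  \<open>q\<^sup>2 + 1 < q ^ 3\<close>. So it leaves the geometric progression of the admissible values.\<close>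

lemma no_offset: "\<not> offset u"
proof
  assume "offset u"
  then obtain v where v: "offset v" "small v" by (rule offset_reaches_small)
  define w where "w = e + q\<^sup>2 * v"
  have w: "offset w" "small w" using offset_step[OF v] small_step[OF v] by (simp_all add: w_def)
  have "e \<le> w" using v(1) by (simp add: w_def offset_def)
  then obtain k where k: "w = c / q ^ Suc (Suc (Suc k))"
    using w(2) e_bounds(1) by (auto simp: small_def numeral_3_eq_3)
  have "0 < w" using \<open>e \<le> w\<close> e_bounds by linarith
  have "1 < q * (q * (q - 1))"
  proof -
    have "1 < q * (q - 1)" using golden by (simp add: power2_eq_square algebra_simps)
    then show ?thesis using q_gt_1 mult_strict_mono[of 1 q 1 "q * (q - 1)"] by simp
  qed
  then have "w * (q\<^sup>2 + 1) < w * q ^ 3"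
    using \<open>0 < w\<close> by (intro mult_strict_left_mono) (simp_all add: power2_eq_square power3_eq_cube algebra_simps)
  moreover have "e + q\<^sup>2 * w \<le> w * (q\<^sup>2 + 1)" using \<open>e \<le> w\<close> by (simp add: algebra_simps)
  moreover have "w * q ^ 3 = c / q ^ k" using k q_gt_1 by (simp add: power3_eq_cube)
  ultimately have "e + q\<^sup>2 * w < c / q ^ k" by linarith
  moreover have "c / q ^ Suc k < e + q\<^sup>2 * w"
    using k e_bounds q_gt_1 by (simp add: power2_eq_square)
  ultimately show False using not_offset_between offset_step[OF w] by blast
qed

theorem multiple_imp_uncountable:
  assumes "multiple x"
  shows "uncountable (q_expansions q x)"
  using uncountable_if_always_splits[OF _ assms] offset_if_multiple_not_splits no_offset by blast

end

theorem corollary1p3: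
  fixes q :: real
  assumes "(1 + sqrt 5) / 2 < q" and "q < q_aleph0"
  shows "(\<exists>x. 0 < x \<and> x < 1 / (q - 1) \<and> uncountable (q_expansions q x))
    \<and> (\<exists>x. 0 < x \<and> x < 1 / (q - 1) \<and> (\<exists>!\<epsilon>. q_expansion q x \<epsilon>))
    \<and> (\<forall>x. 0 < x \<and> x < 1 / (q - 1) \<longrightarrow>
          uncountable (q_expansions q x) \<or> is_singleton (q_expansions q x))"
proof -
  have aleph0: "1 < q_aleph0" "q_aleph0 < 2"
      "q_aleph0 ^ 6 = q_aleph0 ^ 4 + q_aleph0 ^ 3 + 2 * q_aleph0 ^ 2 + q_aleph0 + 1"
    using theI'[OF q_aleph0_ex1] unfolding q_aleph0_def by auto
  define r where "r = sqrt 5"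
  have r: "1 < r" "r * r = 5" by (simp_all add: r_def)
  have q_r: "1 + r < 2 * q" using assms(1) by (simp add: r_def field_simps)
  then have q1: "1 < q" using r(1) by linarith
  have "0 < (2 * q - (1 + r)) * (2 * q - (1 - r))"
    using q_r r(1) by (intro mult_pos_pos) linarith+
  also have "\<dots> = 4 * (q\<^sup>2 - q - 1)" using r(2) by (simp add: algebra_simps power2_eq_square)
  finally have golden: "q + 1 < q\<^sup>2" by simp
  have subcritical: "q ^ 6 < q ^ 4 + q ^ 3 + 2 * q ^ 2 + q + 1"
    using subcritical_mono[of q q_aleph0] q1 assms(2) aleph0(3) by auto
  have "q < 1646 / 1000" using subcritical_less q1 subcritical by simp
  then have "q * (q - 1)\<^sup>2 \<le> (1646 / 1000) * (646 / 1000)\<^sup>2"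
    using q1 by (intro mult_mono power_mono) auto
  then have "q * (q - 1)\<^sup>2 < 1" by (simp add: power2_eq_square)
  then interpret subcritical_base q
    using q1 assms(2) aleph0(2) golden subcritical by unfold_locales auto
  \<comment> \<open>the left end of the switch region, with children \<open>1\<close> and \<open>0\<close>\<close>
  have in_switch: "0 < 1 / q" "1 / q < t" "multiple (1 / q)"
    using q_gt_1 q_mult_t t_gt_1 multiple_if_switch[of "1 / q"]
    by (simp_all add: divide_less_eq mult.commute)
  have two_cycle: "0 < q * c" "q * c < t"
    using c_pos q_gt_1 unfolding t_eq by (simp_all add: algebra_simps)
  show ?thesis
  proof (intro conjI allI impI)
    show "\<exists>x. 0 < x \<and> x < 1 / (q - 1) \<and> uncountable (q_expansions q x)"
      using in_switch multiple_imp_uncountable unfolding t_def by blast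
    show "\<exists>x. 0 < x \<and> x < 1 / (q - 1) \<and> (\<exists>!\<epsilon>. q_expansion q x \<epsilon>)"
      using two_cycle two_cycle_not_multiple not_multiple_iff[of "q * c"] unfolding t_def by force
    fix x
    assume "0 < x \<and> x < 1 / (q - 1)"
    then show "uncountable (q_expansions q x) \<or> is_singleton (q_expansions q x)"
      using multiple_imp_uncountable[of x] not_multiple_iff[of x]
      unfolding t_def by (auto simp: is_singleton_def q_expansions_def)
  qed
qed

end
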